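(* The group $\left((\mathcal{P}\times\mathcal{P})^-,\cup^2\right)$ of reduced two-color partitions under two-color concatenation is isomorphic to the group $(\mathcal{Q},\cdot)$ of rational partitions, where $\cdot$ denotes Schneider's partition multiplication.
   Context: A partition is a finite weakly decreasing sequence of positive integers (its parts); the empty partition $\emptyset$ is allowed; $\mathcal{P}$ is the set of all partitions. A two-color partition is a partition in which each part is assigned one of two colors, white or gray; the order of equal-size parts is irrelevant, so it is the same as a pair (white sub-partition, gray sub-partition) in $\mathcal{P}\times\mathcal{P}$. It is reduced if it contains no pair of parts of the same size and different colors; $(\mathcal{P}\times\mathcal{P})^-$ is the set of reduced two-color partitions. Two-color reduction removes each pair of parts of the same size and different colors (one white together with one gray part of equal size, repeatedly). For $\lambda,\pi\in(\mathcal{P}\times\mathcal{P})^-$, $\lambda\cup^2\pi$ is obtained by concatenating the colored parts of $\lambda$ and $\pi$, reordering by size, and then applying two-color reduction. This is an abelian group with identity $\emptyset$. Rational partitions: to each positive integer $n$ one associates an antipart $n^-$. A rational partition is a finite multiset of parts (positive integers) and antiparts, in which a part $n$ and an antipart $n^-$ annihilate each other pairwise, so that it is written in a form not containing both $n$ and $n^-$ for any $n$; $\mathcal{Q}$ is the set of rational partitions. Schneider's partition multiplication $\cdot$ concatenates the parts and antiparts of the two rational partitions, reorders them, and cancels pairs $n,n^-$; e.g. $(7,6,3,3,1)\cdot(6^-,4^-,3^-,1^-,1^-)=(7,4^-,3,1^-)$. $(\mathcal{Q},\cdot)$ is an abelian group with identity $\emptyset$. *)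

theory Defs
  imports "HOL-Algebra.Group" "HOL-Library.Multiset"
begin

definition is_partition :: "nat list \<Rightarrow> bool" where
  "is_partition xs \<longleftrightarrow> sorted_wrt (\<ge>) xs \<and> (\<forall>x\<in>set xs. 0 < x)"

text \<open>A two-color partition is a pair (white sub-partition, gray sub-partition).\<close>

definition two_color_partitions :: "(nat list \<times> nat list) set" where
  "two_color_partitions = {(w, g). is_partition w \<and> is_partition g}"

definition two_color_reduced :: "nat list \<times> nat list \<Rightarrow> bool" where
  "two_color_reduced p \<longleftrightarrow> set (fst p) \<inter> set (snd p) = {}"

inductive two_color_step :: "nat list \<times> nat list \<Rightarrow> nat list \<times> nat list \<Rightarrow> bool" where
  "n \<in> set w \<Longrightarrow> n \<in> set g \<Longrightarrow> two_color_step (w, g) (remove1 n w, remove1 n g)"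

text \<open>Pairs are removed one at a time, in any order, until none is left. Existence and
  uniqueness of the outcome are shown in \<open>two_color_reduce_ex1\<close> below.\<close>

definition two_color_reduce :: "nat list \<times> nat list \<Rightarrow> nat list \<times> nat list" where
  "two_color_reduce p = (THE q. two_color_step\<^sup>*\<^sup>* p q \<and> two_color_reduced q)"

definition partition_concat :: "nat list \<Rightarrow> nat list \<Rightarrow> nat list" where
  "partition_concat xs ys = rev (sort (xs @ ys))"

definition two_color_concat ::
    "nat list \<times> nat list \<Rightarrow> nat list \<times> nat list \<Rightarrow> nat list \<times> nat list" where
  "two_color_concat p q =
     two_color_reduce (partition_concat (fst p) (fst q), partition_concat (snd p) (snd q))"

definition two_color_group :: "(nat list \<times> nat list) monoid" where
  "two_color_group =
     \<lparr>carrier = {p \<in> two_color_partitions. two_color_reduced p},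
      monoid.mult = two_color_concat,
      monoid.one = ([], [])\<rparr>"

datatype rational_part = Part nat | Antipart nat

definition rational_reduced :: "rational_part multiset \<Rightarrow> bool" where
  "rational_reduced M \<longleftrightarrow> \<not> (\<exists>n. Part n \<in># M \<and> Antipart n \<in># M)"

definition rational_partitions :: "rational_part multiset set" where
  "rational_partitions =
     {M. (\<forall>n. Part n \<in># M \<or> Antipart n \<in># M \<longrightarrow> 0 < n) \<and> rational_reduced M}"

inductive rational_step :: "rational_part multiset \<Rightarrow> rational_part multiset \<Rightarrow> bool" where
  "Part n \<in># M \<Longrightarrow> Antipart n \<in># M \<Longrightarrow> rational_step M (M - {#Part n, Antipart n#})"

text \<open>Existence and uniqueness: \<open>rational_reduce_ex1\<close> below.\<close>

definition rational_reduce :: "rational_part multiset \<Rightarrow> rational_part multiset" where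
  "rational_reduce M = (THE N. rational_step\<^sup>*\<^sup>* M N \<and> rational_reduced N)"

definition rational_mult ::
    "rational_part multiset \<Rightarrow> rational_part multiset \<Rightarrow> rational_part multiset" where
  "rational_mult M N = rational_reduce (M + N)"

definition rational_group :: "rational_part multiset monoid" where
  "rational_group = \<lparr>carrier = rational_partitions, monoid.mult = rational_mult, monoid.one = {#}\<rparr>"

lemma is_partition_eqI:
  assumes "is_partition xs" "is_partition ys" "mset xs = mset ys"
  shows "xs = ys"
proof -
  have "sorted (rev xs)" "sorted (rev ys)"
    using assms(1,2) by (auto simp: is_partition_def sorted_wrt_rev)
  then have "rev xs = rev ys"
    using assms(3) by (metis mset_rev properties_for_sort)
  then show ?thesis by simp
qed

lemma is_partition_remove1: "is_partition xs \<Longrightarrow> is_partition (remove1 n xs)"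
proof (induction xs)
  case (Cons a xs)
  then show ?case
    using set_remove1_subset[of n xs] by (auto simp: is_partition_def)
qed simp

lemma two_color_step_invariants:
  assumes "two_color_step\<^sup>*\<^sup>* p q" "p \<in> two_color_partitions"
  shows "q \<in> two_color_partitions \<and>
    mset (fst q) - mset (snd q) = mset (fst p) - mset (snd p) \<and>
    mset (snd q) - mset (fst q) = mset (snd p) - mset (fst p)"
  using assms(1)
proof (induction rule: rtranclp_induct)
  case base
  then show ?case using assms(2) by simp
next
  case (step q r)
  from step.hyps(2) obtain n w g where
    q: "q = (w, g)" and r: "r = (remove1 n w, remove1 n g)" and n: "n \<in> set w" "n \<in> set g"
    by (auto elim: two_color_step.cases)
  obtain W G where "mset w = add_mset n W" "mset g = add_mset n G"
    using n by (metis mset_add set_mset_mset)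
  then show ?case using step.IH q r
    by (auto simp: two_color_partitions_def is_partition_remove1)
qed

lemma two_color_reduce_ex1:
  assumes "p \<in> two_color_partitions"
  shows "\<exists>!q. two_color_step\<^sup>*\<^sup>* p q \<and> two_color_reduced q"
proof (rule ex_ex1I)
  show "\<exists>q. two_color_step\<^sup>*\<^sup>* p q \<and> two_color_reduced q"
  proof (induction "length (fst p)" arbitrary: p rule: less_induct)
    case less
    obtain w g where p: "p = (w, g)" by (cases p)
    show ?case
    proof (cases "two_color_reduced p")
      case False
      then obtain n where n: "n \<in> set w" "n \<in> set g"
        using p by (auto simp: two_color_reduced_def)
      have s: "two_color_step p (remove1 n w, remove1 n g)"
        using n p by (auto intro: two_color_step.intros)
      have "length (remove1 n w) < length (fst p)"
        using n p length_pos_if_in_set[OF n(1)] by (simp add: length_remove1)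
      then show ?thesis
        using less[of "(remove1 n w, remove1 n g)"] s
        by (auto intro: converse_rtranclp_into_rtranclp)
    qed blast
  qed
next
  fix q r
  assume q: "two_color_step\<^sup>*\<^sup>* p q \<and> two_color_reduced q"
    and r: "two_color_step\<^sup>*\<^sup>* p r \<and> two_color_reduced r"
  have diff: "mset (fst s) - mset (snd s) = mset (fst s) \<and>
      mset (snd s) - mset (fst s) = mset (snd s)" if "two_color_reduced s" for s
    using that by (auto simp: two_color_reduced_def multiset_eq_iff)
      (metis count_mset_0_iff diff_zero diff_0_eq_0 disjoint_iff)+
  have "mset (fst q) = mset (fst r)" "mset (snd q) = mset (snd r)"
    using two_color_step_invariants[OF _ assms] q r diff[of q] diff[of r] by metis+
  moreover have "q \<in> two_color_partitions" "r \<in> two_color_partitions"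
    using two_color_step_invariants[OF _ assms] q r by blast+
  ultimately show "q = r"
    by (auto simp: two_color_partitions_def prod_eq_iff intro!: is_partition_eqI)
qed

lemma rational_step_invariant:
  assumes "rational_step\<^sup>*\<^sup>* M N"
  shows "int (count N (Part n)) - int (count N (Antipart n)) =
    int (count M (Part n)) - int (count M (Antipart n))"
  using assms
proof (induction rule: rtranclp_induct)
  case (step N K)
  then obtain m where m: "Part m \<in># N" "Antipart m \<in># N" "K = N - {#Part m, Antipart m#}"
    by (auto elim: rational_step.cases)
  have "0 < count N (Part m)" "0 < count N (Antipart m)"
    using m by (simp_all only: count_greater_zero_iff)
  then have "int (count K (Part n)) - int (count K (Antipart n)) =
      int (count N (Part n)) - int (count N (Antipart n))"
    using m(3) by (cases "n = m") auto
  then show ?case using step.IH by simp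
qed simp

lemma rational_reduce_ex1: "\<exists>!N. rational_step\<^sup>*\<^sup>* M N \<and> rational_reduced N"
proof (rule ex_ex1I)
  show "\<exists>N. rational_step\<^sup>*\<^sup>* M N \<and> rational_reduced N"
  proof (induction "size M" arbitrary: M rule: less_induct)
    case less
    show ?case
    proof (cases "rational_reduced M")
      case False
      then obtain n where n: "Part n \<in># M" "Antipart n \<in># M"
        by (auto simp: rational_reduced_def)
      let ?N = "M - {#Part n, Antipart n#}"
      have "size ?N < size M"
        using size_Diff1_less[OF n(1)] size_Diff1_le[of "M - {#Part n#}" "Antipart n"]
        by (simp only: add_mset_add_single[of "Part n" "{#Antipart n#}"] diff_diff_add_mset[symmetric]
            add.commute[of "{#Antipart n#}"])
      then obtain K where "rational_step\<^sup>*\<^sup>* ?N K" "rational_reduced K"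
        using less by blast
      then show ?thesis
        using n by (meson converse_rtranclp_into_rtranclp rational_step.intros)
    qed auto
  qed
next
  fix N K
  assume N: "rational_step\<^sup>*\<^sup>* M N \<and> rational_reduced N"
    and K: "rational_step\<^sup>*\<^sup>* M K \<and> rational_reduced K"
  have z: "count L (Part n) = 0 \<or> count L (Antipart n) = 0" if "rational_reduced L" for L n
    using that by (auto simp: rational_reduced_def count_eq_zero_iff)
  have "count N (Part n) = count K (Part n) \<and> count N (Antipart n) = count K (Antipart n)" for n
    using z[of N n] z[of K n] N K rational_step_invariant[of M N n] rational_step_invariant[of M K n]
    by auto
  then show "N = K"
    by (metis multiset_eqI rational_part.exhaust)
qed

end

theory Submission
  imports Defs
begin

text \<open>Both groups are copies of the group of finitely supported functions from the positive
  integers to the integers: a two-color partition is sent to the number of white minus the number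
  of gray parts of each size, a rational partition to the number of parts minus the number of
  antiparts. Cancelling a pair leaves this difference unchanged, and a reduced object is determined
  by it, as the positive and negative parts of the difference.\<close>

section \<open>Transport of group structure along a bijection\<close>

text \<open>Injectivity of \<open>h\<close> reduces each group equation in \<open>G\<close> to one
  in \<open>H\<close>, and surjectivity supplies inverses. Associativity of an operation followed by
  cancellation thus never has to be checked directly.\<close>

lemma group_iso_of_bij_betw:
  assumes "group H"
    and bij: "bij_betw h (carrier G) (carrier H)"
    and closed: "\<And>x y. x \<in> carrier G \<Longrightarrow> y \<in> carrier G \<Longrightarrow> x \<otimes>\<^bsub>G\<^esub> y \<in> carrier G"
    and one: "\<one>\<^bsub>G\<^esub> \<in> carrier G" "h \<one>\<^bsub>G\<^esub> = \<one>\<^bsub>H\<^esub>"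
    and mult: "\<And>x y. x \<in> carrier G \<Longrightarrow> y \<in> carrier G \<Longrightarrow> h (x \<otimes>\<^bsub>G\<^esub> y) = h x \<otimes>\<^bsub>H\<^esub> h y"
  shows "group G" "G \<cong> H"
proof -
  interpret H: group H by fact
  have hc: "h x \<in> carrier H" if "x \<in> carrier G" for x
    using bij that by (auto simp: bij_betw_def)
  have inj: "x = y" if "x \<in> carrier G" "y \<in> carrier G" "h x = h y" for x y
    using bij that by (auto simp: bij_betw_def inj_on_def)
  show "group G"
  proof (rule groupI)
    fix x assume x: "x \<in> carrier G"
    obtain y where y: "y \<in> carrier G" "h y = inv\<^bsub>H\<^esub> h x"
      using bij H.inv_closed[OF hc[OF x]] unfolding bij_betw_def by (metis imageE)
    have "y \<otimes>\<^bsub>G\<^esub> x = \<one>\<^bsub>G\<^esub>"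
      using x y by (intro inj) (simp_all add: closed one mult hc)
    with y show "\<exists>y\<in>carrier G. y \<otimes>\<^bsub>G\<^esub> x = \<one>\<^bsub>G\<^esub>" by blast
  qed (auto intro!: inj simp: closed one mult hc H.m_assoc)
  show "G \<cong> H"
    using bij hc mult by (auto simp: is_iso_def iso_def hom_def)
qed

section \<open>Finitely supported integer functions as differences of multisets\<close>

text \<open>This is the free abelian group on the positive integers; the condition at 0 reflects
  that parts are positive although their type is \<open>nat\<close>.\<close>

definition finsupp_int_group :: "(nat \<Rightarrow> int) monoid" where
  "finsupp_int_group =
     \<lparr>carrier = {f. f 0 = 0 \<and> finite {n. f n \<noteq> 0}},
      monoid.mult = (\<lambda>f g n. f n + g n),
      monoid.one = (\<lambda>_. 0)\<rparr>"

lemma group_finsupp_int_group: "group finsupp_int_group"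
proof (rule groupI)
  fix f g assume "f \<in> carrier finsupp_int_group" "g \<in> carrier finsupp_int_group"
  moreover have "{n. f n + g n \<noteq> 0} \<subseteq> {n. f n \<noteq> 0} \<union> {n. g n \<noteq> 0}" by auto
  ultimately show "f \<otimes>\<^bsub>finsupp_int_group\<^esub> g \<in> carrier finsupp_int_group"
    by (auto simp: finsupp_int_group_def dest: finite_subset)
next
  fix f assume "f \<in> carrier finsupp_int_group"
  then show "\<exists>g\<in>carrier finsupp_int_group.
      g \<otimes>\<^bsub>finsupp_int_group\<^esub> f = \<one>\<^bsub>finsupp_int_group\<^esub>"
    by (intro bexI[of _ "\<lambda>n. - f n"]) (auto simp: finsupp_int_group_def)
qed (auto simp: finsupp_int_group_def algebra_simps)

text \<open>Unlike truncated multiset subtraction, this signed difference is additive.\<close>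

definition mset_diff :: "'a multiset \<Rightarrow> 'a multiset \<Rightarrow> 'a \<Rightarrow> int" where
  "mset_diff A B = (\<lambda>n. int (count A n) - int (count B n))"

lemma mset_diff_plus:
  "mset_diff (A + C) (B + D) = (\<lambda>n. mset_diff A B n + mset_diff C D n)"
  by (auto simp: mset_diff_def)

text \<open>Disjointness makes one of the two counts vanish at each point, so they are the positive
  and negative parts of the difference.\<close>

lemma mset_diff_disjoint_inject:
  assumes "mset_diff A B = mset_diff C D"
    and "set_mset A \<inter> set_mset B = {}" "set_mset C \<inter> set_mset D = {}"
  shows "A = C \<and> B = D"
proof -
  have "count A n = count C n \<and> count B n = count D n" for n
  proof -
    have "count A n = 0 \<or> count B n = 0" "count C n = 0 \<or> count D n = 0"
      using assms(2,3) by (auto simp: count_eq_zero_iff)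
    moreover have "int (count A n) - int (count B n) = int (count C n) - int (count D n)"
      using assms(1) by (metis mset_diff_def)
    ultimately show ?thesis by linarith
  qed
  then show ?thesis by (simp add: multiset_eq_iff)
qed

lemma mset_diff_in_finsupp_int_group:
  assumes "0 \<notin># A" "0 \<notin># B"
  shows "mset_diff A B \<in> carrier finsupp_int_group"
proof -
  have "{n. mset_diff A B n \<noteq> 0} \<subseteq> set_mset A \<union> set_mset B"
    by (auto simp: mset_diff_def simp flip: count_greater_zero_iff)
  then have "finite {n. mset_diff A B n \<noteq> 0}"
    by (rule finite_subset) simp
  then show ?thesis
    using assms by (simp add: finsupp_int_group_def mset_diff_def not_in_iff)
qed

lemma finsupp_int_group_mset_diff:
  assumes "f \<in> carrier finsupp_int_group"
  obtains A B where "f = mset_diff A B" "set_mset A \<inter> set_mset B = {}" "0 \<notin># A" "0 \<notin># B"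
proof -
  have f: "f 0 = 0" "finite {n. f n \<noteq> 0}"
    using assms by (auto simp: finsupp_int_group_def)
  \<comment> \<open>Since \<open>nat\<close> sends negative integers to 0, these are the positive
    and negative parts of \<open>f\<close>, and no element lies in both. Finite support ensures that
    \<open>count\<close> returns the given functions.\<close>
  define A B where "A = Abs_multiset (\<lambda>n. nat (f n))" and "B = Abs_multiset (\<lambda>n. nat (- f n))"
  have "finite {n. 0 < nat (f n)}" "finite {n. 0 < nat (- f n)}"
    by (rule finite_subset[OF _ f(2)]; auto)+
  then have c: "count A n = nat (f n)" "count B n = nat (- f n)" for n
    by (simp_all add: A_def B_def)
  show thesis
  proof
    show "f = mset_diff A B" by (auto simp: mset_diff_def c)
    show "set_mset A \<inter> set_mset B = {}"
      by (auto simp flip: count_greater_zero_iff simp: c)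
    show "0 \<notin># A" "0 \<notin># B" by (simp_all add: not_in_iff c f)
  qed
qed

section \<open>Reduced two-color partitions\<close>

definition color_diff :: "nat list \<times> nat list \<Rightarrow> nat \<Rightarrow> int" where
  "color_diff p = mset_diff (mset (fst p)) (mset (snd p))"

lemma two_color_reduce:
  assumes "p \<in> two_color_partitions"
  shows "two_color_reduce p \<in> carrier two_color_group"
    and "color_diff (two_color_reduce p) = color_diff p"
proof -
  have q: "two_color_step\<^sup>*\<^sup>* p (two_color_reduce p) \<and> two_color_reduced (two_color_reduce p)"
    unfolding two_color_reduce_def by (rule theI'[OF two_color_reduce_ex1[OF assms]])
  then show "two_color_reduce p \<in> carrier two_color_group"
    using two_color_step_invariants[OF _ assms] by (auto simp: two_color_group_def)
  let ?q = "two_color_reduce p"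
  have "mset (fst ?q) - mset (snd ?q) = mset (fst p) - mset (snd p)"
    "mset (snd ?q) - mset (fst ?q) = mset (snd p) - mset (fst p)"
    using two_color_step_invariants[OF _ assms] q by blast+
  \<comment> \<open>Subtraction on \<open>nat\<close> is truncated, so both directions are needed to
    recover the signed difference.\<close>
  then have "count (mset (fst ?q)) n - count (mset (snd ?q)) n = count (mset (fst p)) n - count (mset (snd p)) n"
    "count (mset (snd ?q)) n - count (mset (fst ?q)) n = count (mset (snd p)) n - count (mset (fst p)) n" for n
    by (metis count_diff)+
  then show "color_diff ?q = color_diff p"
    unfolding color_diff_def mset_diff_def by (intro ext) (smt (verit) int_ops(6))
qed

text \<open>Concatenation adds multiplicities and reduction preserves the color difference, so
  \<open>color_diff\<close> is a homomorphism.\<close>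

lemma two_color_concat:
  assumes "p \<in> carrier two_color_group" "q \<in> carrier two_color_group"
  shows "two_color_concat p q \<in> carrier two_color_group"
    and "color_diff (two_color_concat p q) = (\<lambda>n. color_diff p n + color_diff q n)"
proof -
  let ?r = "(partition_concat (fst p) (fst q), partition_concat (snd p) (snd q))"
  have r: "?r \<in> two_color_partitions"
    using assms by (auto simp: two_color_group_def two_color_partitions_def is_partition_def
        partition_concat_def sorted_wrt_rev simp del: sort_append)
  show "two_color_concat p q \<in> carrier two_color_group"
    using two_color_reduce(1)[OF r] by (simp add: two_color_concat_def)
  show "color_diff (two_color_concat p q) = (\<lambda>n. color_diff p n + color_diff q n)"
    using two_color_reduce(2)[OF r]
    by (simp add: two_color_concat_def color_diff_def partition_concat_def mset_diff_plus)
qed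

lemma bij_betw_color_diff:
  "bij_betw color_diff (carrier two_color_group) (carrier finsupp_int_group)"
  unfolding bij_betw_def
proof (intro conjI equalityI subsetI)
  show "inj_on color_diff (carrier two_color_group)"
  proof (rule inj_onI)
    fix p q
    assume p: "p \<in> carrier two_color_group" and q: "q \<in> carrier two_color_group"
      and "color_diff p = color_diff q"
    \<comment> \<open>Reducedness is the disjointness needed here; weakly decreasing lists are then
      determined by their multisets.\<close>
    then have "mset (fst p) = mset (fst q) \<and> mset (snd p) = mset (snd q)"
      by (intro mset_diff_disjoint_inject)
        (auto simp: color_diff_def two_color_group_def two_color_reduced_def)
    with p q show "p = q"
      by (auto simp: two_color_group_def two_color_partitions_def intro!: is_partition_eqI)
  qed
  show "f \<in> carrier finsupp_int_group" if "f \<in> color_diff ` carrier two_color_group" for f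
    using that by (auto simp: color_diff_def two_color_group_def two_color_partitions_def
        is_partition_def intro!: mset_diff_in_finsupp_int_group)
  fix f assume "f \<in> carrier finsupp_int_group"
  then obtain A B where
    f: "f = mset_diff A B" "set_mset A \<inter> set_mset B = {}" "0 \<notin># A" "0 \<notin># B"
    by (rule finsupp_int_group_mset_diff)
  \<comment> \<open>White parts carry the positive values of \<open>f\<close>, gray parts the
    negative ones; \<open>rev\<close> turns ascending lists into weakly decreasing ones.\<close>
  let ?p = "(rev (sorted_list_of_multiset A), rev (sorted_list_of_multiset B))"
  have "?p \<in> carrier two_color_group"
    using f(2-4) by (auto simp: two_color_group_def two_color_partitions_def two_color_reduced_def
        is_partition_def sorted_wrt_rev intro: gr0I)
  moreover have "f = color_diff ?p"
    by (simp add: f(1) color_diff_def)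
  ultimately show "f \<in> color_diff ` carrier two_color_group" by (rule rev_image_eqI)
qed

lemma two_color_group_iso:
  "group two_color_group" "two_color_group \<cong> finsupp_int_group"
proof -
  let ?G = two_color_group and ?H = finsupp_int_group
  have one: "\<one>\<^bsub>?G\<^esub> \<in> carrier ?G" "color_diff \<one>\<^bsub>?G\<^esub> = \<one>\<^bsub>?H\<^esub>"
    by (auto simp: two_color_group_def two_color_partitions_def two_color_reduced_def
        is_partition_def color_diff_def mset_diff_def finsupp_int_group_def)
  have mult: "p \<otimes>\<^bsub>?G\<^esub> q \<in> carrier ?G"
    "color_diff (p \<otimes>\<^bsub>?G\<^esub> q) = color_diff p \<otimes>\<^bsub>?H\<^esub> color_diff q"
    if "p \<in> carrier ?G" "q \<in> carrier ?G" for p q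
    using two_color_concat[OF that] by (simp_all add: two_color_group_def finsupp_int_group_def)
  show "group ?G" "?G \<cong> ?H"
    using group_iso_of_bij_betw[OF group_finsupp_int_group bij_betw_color_diff mult(1) one mult(2)]
    by blast+
qed

section \<open>Rational partitions\<close>

text \<open>Its values are the quantities that \<open>rational_step_invariant\<close> shows to be
  preserved by cancellation.\<close>

definition part_diff :: "rational_part multiset \<Rightarrow> nat \<Rightarrow> int" where
  "part_diff M = (\<lambda>n. int (count M (Part n)) - int (count M (Antipart n)))"

text \<open>Cancellation only deletes elements. This keeps all sizes positive in a product.\<close>

lemma rational_step_subset: "rational_step\<^sup>*\<^sup>* M N \<Longrightarrow> N \<subseteq># M"
proof (induction rule: rtranclp_induct)
  case (step N K)
  then show ?case
    by (metis diff_subset_eq_self rational_step.cases subset_mset.order_trans)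
qed simp

lemma rational_mult:
  assumes "M \<in> carrier rational_group" "N \<in> carrier rational_group"
  shows "rational_mult M N \<in> carrier rational_group"
    and "part_diff (rational_mult M N) = (\<lambda>n. part_diff M n + part_diff N n)"
proof -
  have r: "rational_step\<^sup>*\<^sup>* (M + N) (rational_mult M N) \<and> rational_reduced (rational_mult M N)"
    unfolding rational_mult_def rational_reduce_def by (rule theI'[OF rational_reduce_ex1])
  then have "set_mset (rational_mult M N) \<subseteq> set_mset M \<union> set_mset N"
    by (metis rational_step_subset set_mset_mono set_mset_union)
  then show "rational_mult M N \<in> carrier rational_group"
    using r assms by (auto simp: rational_group_def rational_partitions_def)
  show "part_diff (rational_mult M N) = (\<lambda>n. part_diff M n + part_diff N n)"
    using rational_step_invariant r by (auto simp: part_diff_def)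
qed

lemma count_image_mset_inj: "inj f \<Longrightarrow> count (image_mset f A) (f x) = count A x"
  by (induction A) (auto simp: inj_eq)

lemma bij_betw_part_diff:
  "bij_betw part_diff (carrier rational_group) (carrier finsupp_int_group)"
  unfolding bij_betw_def
proof (intro conjI equalityI subsetI)
  have inj_constr: "inj Part" "inj Antipart" by (auto simp: inj_on_def)
  show "inj_on part_diff (carrier rational_group)"
  proof (rule inj_onI)
    fix M N
    assume M: "M \<in> carrier rational_group" and N: "N \<in> carrier rational_group"
      and eq: "part_diff M = part_diff N"
    have "count M (Part n) = count N (Part n) \<and> count M (Antipart n) = count N (Antipart n)" for n
    proof -
      have "count M (Part n) = 0 \<or> count M (Antipart n) = 0"
        "count N (Part n) = 0 \<or> count N (Antipart n) = 0"
        using M N by (auto simp: rational_group_def rational_partitions_def rational_reduced_def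
            count_eq_zero_iff)
      moreover have "int (count M (Part n)) - int (count M (Antipart n)) =
          int (count N (Part n)) - int (count N (Antipart n))"
        using eq by (metis part_diff_def)
      ultimately show ?thesis by linarith
    qed
    then show "M = N" by (metis multiset_eqI rational_part.exhaust)
  qed
  show "f \<in> carrier finsupp_int_group" if f: "f \<in> part_diff ` carrier rational_group" for f
  proof -
    obtain M where M: "M \<in> carrier rational_group" "f = part_diff M" using f by blast
    \<comment> \<open>Preimages of a finite set under the injective constructors are finite.\<close>
    have "{n. f n \<noteq> 0} \<subseteq> Part -` set_mset M \<union> Antipart -` set_mset M"
      by (auto simp: M(2) part_diff_def simp flip: count_greater_zero_iff)
    then have "finite {n. f n \<noteq> 0}"
      by (rule finite_subset) (simp add: finite_vimageI inj_constr)
    moreover have "Part 0 \<notin># M" "Antipart 0 \<notin># M"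
      using M by (auto simp: rational_group_def rational_partitions_def)
    then have "f 0 = 0" by (simp add: M(2) part_diff_def not_in_iff)
    ultimately show ?thesis by (simp add: finsupp_int_group_def)
  qed
  fix f assume "f \<in> carrier finsupp_int_group"
  then obtain A B where
    f: "f = mset_diff A B" "set_mset A \<inter> set_mset B = {}" "0 \<notin># A" "0 \<notin># B"
    by (rule finsupp_int_group_mset_diff)
  \<comment> \<open>Positive values of \<open>f\<close> become parts and negative ones antiparts;
    disjointness of \<open>A\<close> and \<open>B\<close> makes the union reduced.\<close>
  let ?M = "image_mset Part A + image_mset Antipart B"
  have "?M \<in> carrier rational_group"
    using f(2-4) by (auto simp: rational_group_def rational_partitions_def rational_reduced_def
        intro: gr0I)
  moreover have "f = part_diff ?M"
  proof
    fix n
    \<comment> \<open>The constructors have disjoint ranges, so neither summand affects the count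
      belonging to the other.\<close>
    have "count (image_mset Antipart B) (Part n) = 0" "count (image_mset Part A) (Antipart n) = 0"
      by (auto simp: count_eq_zero_iff)
    then show "f n = part_diff ?M n"
      by (simp add: f(1) part_diff_def mset_diff_def count_image_mset_inj inj_constr)
  qed
  ultimately show "f \<in> part_diff ` carrier rational_group" by (rule rev_image_eqI)
qed

lemma rational_group_iso:
  "group rational_group" "rational_group \<cong> finsupp_int_group"
proof -
  let ?G = rational_group and ?H = finsupp_int_group
  have one: "\<one>\<^bsub>?G\<^esub> \<in> carrier ?G" "part_diff \<one>\<^bsub>?G\<^esub> = \<one>\<^bsub>?H\<^esub>"
    by (auto simp: rational_group_def rational_partitions_def rational_reduced_def
        part_diff_def finsupp_int_group_def)
  have mult: "M \<otimes>\<^bsub>?G\<^esub> N \<in> carrier ?G"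
    "part_diff (M \<otimes>\<^bsub>?G\<^esub> N) = part_diff M \<otimes>\<^bsub>?H\<^esub> part_diff N"
    if "M \<in> carrier ?G" "N \<in> carrier ?G" for M N
    using rational_mult[OF that] by (simp_all add: rational_group_def finsupp_int_group_def)
  show "group ?G" "?G \<cong> ?H"
    using group_iso_of_bij_betw[OF group_finsupp_int_group bij_betw_part_diff mult(1) one mult(2)]
    by blast+
qed

theorem theorem8:
  shows "group two_color_group \<and> group rational_group \<and> two_color_group \<cong> rational_group"
  \<comment> \<open>The isomorphism out of \<open>rational_group\<close> is inverted and composed
    with the one out of \<open>two_color_group\<close>.\<close>
  using two_color_group_iso rational_group_iso iso_trans group.iso_sym by blast

end
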